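(* Let $\epsilon,\eta,\beta_0\in(0,1)$ and let $P\subset\mathbb{R}^d$ be an $n$-point $(\epsilon^2,\beta)$-stable instance with $\beta>\beta_0$. Consider the following algorithm: (1) sample a set $S$ of $\Theta\big(\frac{1}{\beta_0}\max\{\log\frac{1}{\eta},\,d\log\frac{d}{\beta_0}\}\big)$ points from $P$ independently and uniformly at random (with a sufficiently large absolute constant in the $\Theta$); (2) compute any $(1+\epsilon^2)$-radius approximate MEB of $S$, i.e. a ball $\mathbb{B}(c,r)$ containing $S$ with $r\le(1+\epsilon^2)\mathbf{Rad}(S)$; (3) output the ball $\mathbb{B}\big(c,\frac{1+(2\sqrt{2}+\sqrt{3})\epsilon}{1-\epsilon^2}r\big)$. Then with probability at least $1-\eta$ the output ball contains $P$ and has radius at most $\lambda\,\mathbf{Rad}(P)$, where $$\lambda=\frac{\big(1+(2\sqrt{2}+\sqrt{3})\epsilon\big)(1+\epsilon^2)}{1-\epsilon^2}=1+O(\epsilon).$$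
   Context: For a finite set $P\subset\mathbb{R}^d$, $\mathbf{MEB}(P)$ denotes the closed ball of minimum radius containing $P$ and $\mathbf{Rad}(P)$ its radius; $\mathbb{B}(c,r)$ is the closed Euclidean ball with center $c$ and radius $r$. Given an $n$-point set $P\subset\mathbb{R}^d$ and $\alpha,\beta\in(0,1)$, $P$ is $(\alpha,\beta)$-stable if (1) $\mathbf{Rad}(P\setminus Q)>(1-\alpha)\mathbf{Rad}(P)$ for every $Q\subset P$ with $|Q|<\beta n$, and (2) there exists $Q'\subset P$ with $|Q'|=\lceil\beta n\rceil$ and $\mathbf{Rad}(P\setminus Q')\le(1-\alpha)\mathbf{Rad}(P)$.
   Formalization: The maximum in the sample size also includes the entry 1, since for d=1 with β₀ and η near 1 the literal bound tends to 0, allows a single sample point, and the claim then fails; for d≥2, or β₀ or η at most 1/e, nothing changes. *)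

theory Defs
  imports "HOL-Probability.Probability" "HOL-Library.Landau_Symbols"
begin

text \<open>
  The constant hidden in the sample size must not depend on the dimension, so \<open>d\<close> has to be
  quantified inside the statement. Hence \<open>\<real>\<^sup>d\<close> is the carrier of the library's
  \<^const>\<open>Euclidean_space\<close>: functions \<open>nat \<Rightarrow> real\<close> that vanish at every index \<open>i \<ge> d\<close>.
\<close>

abbreviation Rd :: "nat \<Rightarrow> (nat \<Rightarrow> real) set" where
  "Rd d \<equiv> topspace (Euclidean_space d)"

definition edist :: "nat \<Rightarrow> (nat \<Rightarrow> real) \<Rightarrow> (nat \<Rightarrow> real) \<Rightarrow> real" where
  "edist d x y = L2_set (\<lambda>i. x i - y i) {..<d}"

definition closed_ball :: "nat \<Rightarrow> (nat \<Rightarrow> real) \<Rightarrow> real \<Rightarrow> (nat \<Rightarrow> real) set" where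
  "closed_ball d c r = {x \<in> Rd d. edist d c x \<le> r}"

definition is_MEB :: "nat \<Rightarrow> (nat \<Rightarrow> real) set \<Rightarrow> (nat \<Rightarrow> real) \<Rightarrow> real \<Rightarrow> bool" where
  "is_MEB d P c r \<longleftrightarrow>
     c \<in> Rd d \<and> 0 \<le> r \<and> P \<subseteq> closed_ball d c r \<and>
     (\<forall>c' r'. c' \<in> Rd d \<and> 0 \<le> r' \<and> P \<subseteq> closed_ball d c' r' \<longrightarrow> r \<le> r')"

definition Rad :: "nat \<Rightarrow> (nat \<Rightarrow> real) set \<Rightarrow> real" where
  "Rad d P = (THE r. \<exists>c. is_MEB d P c r)"

definition stable_instance :: "nat \<Rightarrow> (nat \<Rightarrow> real) set \<Rightarrow> real \<Rightarrow> real \<Rightarrow> bool" where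
  "stable_instance d P \<alpha> \<beta> \<longleftrightarrow>
     (\<forall>Q. Q \<subseteq> P \<and> real (card Q) < \<beta> * real (card P) \<longrightarrow>
          Rad d (P - Q) > (1 - \<alpha>) * Rad d P) \<and>
     (\<exists>Q'. Q' \<subseteq> P \<and> int (card Q') = \<lceil>\<beta> * real (card P)\<rceil> \<and>
          Rad d (P - Q') \<le> (1 - \<alpha>) * Rad d P)"

definition approx_MEB :: "nat \<Rightarrow> real \<Rightarrow> (nat \<Rightarrow> real) set \<Rightarrow> (nat \<Rightarrow> real) \<Rightarrow> real \<Rightarrow> bool" where
  "approx_MEB d \<delta> S c r \<longleftrightarrow>
     c \<in> Rd d \<and> 0 \<le> r \<and> S \<subseteq> closed_ball d c r \<and> r \<le> (1 + \<delta>) * Rad d S"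

text \<open>
  The expression inside the \<open>\<Theta>\<close> of the sample size. The entry \<open>1\<close> is the usual convention that a
  \<open>\<Theta>\<close>-bound is at least constant. It has no effect for \<open>d \<ge> 2\<close>, where \<open>d ln (d / \<beta>\<^sub>0) > 1\<close>, nor when
  \<open>\<beta>\<^sub>0\<close> or \<open>\<eta>\<close> is at most \<open>exp (- 1)\<close>; for \<open>d = 1\<close> with \<open>\<beta>\<^sub>0\<close> and \<open>\<eta>\<close> both close to \<open>1\<close> the other two
  entries tend to \<open>0\<close>, and no absolute constant would enforce even two sample points.
\<close>

definition sample_bound :: "nat \<Rightarrow> real \<Rightarrow> real \<Rightarrow> real" where
  "sample_bound d \<beta>\<^sub>0 \<eta> = 1 / \<beta>\<^sub>0 * Max {1, ln (1 / \<eta>), real d * ln (real d / \<beta>\<^sub>0)}"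

definition approx_ratio :: "real \<Rightarrow> real" where
  "approx_ratio \<epsilon> = (1 + (2 * sqrt 2 + sqrt 3) * \<epsilon>) * (1 + \<epsilon>\<^sup>2) / (1 - \<epsilon>\<^sup>2)"

end

theory Submission
  imports Defs "HOL-Real_Asymp.Real_Asymp"
begin

text \<open>
  The minimum enclosing ball of a sample \<open>S\<close> is already the minimum enclosing ball of at most \<open>d + 1\<close>
  of its points. It is thus a sample compression scheme of size \<open>d + 1\<close>: a union bound over the
  positions of these points shows that it misses at least \<open>\<beta> n\<close> points of \<open>P\<close> with probability at most
  \<open>m\<^bsup>d+1\<^esup> (1 - \<beta>)\<^bsup>m-d-1\<^esup>\<close>, so no VC theory is needed. Otherwise stability gives
  \<open>Rad S > (1 - \<epsilon>\<^sup>2) Rad P\<close>. A ball of radius \<open>r\<close> around \<open>c\<close> that contains \<open>S\<close> satisfies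
  \<open>|c - c\<^sub>S|\<^sup>2 \<le> r\<^sup>2 - (Rad S)\<^sup>2\<close>, where \<open>c\<^sub>S\<close> is the optimal center. Applied to the approximate ball of \<open>S\<close>
  and to the optimal ball of \<open>P\<close>, this puts \<open>c\<close> at distance at most \<open>(\<surd>3 + \<surd>2) \<epsilon> Rad P\<close> from the
  optimal center of \<open>P\<close>.
\<close>

subsection \<open>Squared distances\<close>

text \<open>Without the square root, comparisons of distances reduce to polynomial identities in
  each coordinate.\<close>

definition sqd :: "nat \<Rightarrow> (nat \<Rightarrow> real) \<Rightarrow> (nat \<Rightarrow> real) \<Rightarrow> real" where
  "sqd d x y = (\<Sum>i<d. (x i - y i)\<^sup>2)"

lemma sqd_nonneg: "0 \<le> sqd d x y"
  by (simp add: sqd_def sum_nonneg)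

lemma edist_eq_sqrt_sqd: "edist d x y = sqrt (sqd d x y)"
  by (simp add: edist_def sqd_def L2_set_def)

lemma edist_le_iff: "0 \<le> r \<Longrightarrow> edist d x y \<le> r \<longleftrightarrow> sqd d x y \<le> r\<^sup>2"
  unfolding edist_eq_sqrt_sqd
  by (metis real_sqrt_le_iff real_sqrt_unique)

lemma edist_triangle: "edist d x z \<le> edist d x y + edist d y z"
  using L2_set_triangle_ineq[of "\<lambda>i. x i - y i" "\<lambda>i. y i - z i" "{..<d}"]
  by (simp add: edist_def)

lemma edist_commute: "edist d x y = edist d y x"
  by (simp add: edist_eq_sqrt_sqd sqd_def power2_commute)

lemma Rd_iff: "x \<in> Rd d \<longleftrightarrow> (\<forall>i\<ge>d. x i = 0)"
  by (simp add: topspace_Euclidean_space)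

lemma sqd_eq_0_iff:
  assumes "x \<in> Rd d" "y \<in> Rd d"
  shows "sqd d x y = 0 \<longleftrightarrow> x = y"
proof
  assume "sqd d x y = 0"
  then have "\<forall>i<d. x i = y i"
    by (simp add: sqd_def sum_nonneg_eq_0_iff)
  then show "x = y"
    using assms unfolding Rd_iff by (metis ext not_less)
qed (simp add: sqd_def)

text \<open>Stewart's identity. The negative last term measures how much moving along a segment
  improves on convexity; existence, uniqueness and stability of centers all come from it.\<close>

lemma sqd_segment:
  "sqd d (\<lambda>i. (1 - t) * a i + t * b i) x =
     (1 - t) * sqd d a x + t * sqd d b x - t * (1 - t) * sqd d a b"
proof -
  have "((1 - t) * a i + t * b i - x i)\<^sup>2 =
      (1 - t) * (a i - x i)\<^sup>2 + t * (b i - x i)\<^sup>2 - t * (1 - t) * (a i - b i)\<^sup>2" for i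
    by algebra
  then show ?thesis
    by (simp add: sqd_def sum.distrib sum_subtractf sum_distrib_left)
qed

text \<open>The right side exceeds the left by the weighted variance of \<open>a\<close> about its
  mean \<open>s\<close>, which is nonnegative.\<close>

lemma square_weighted_mean_le:
  fixes w a :: "'a \<Rightarrow> real"
  assumes "finite I" "\<And>j. j \<in> I \<Longrightarrow> 0 \<le> w j" "(\<Sum>j\<in>I. w j) = 1"
  shows "((\<Sum>j\<in>I. w j * a j) - x)\<^sup>2 \<le> (\<Sum>j\<in>I. w j * (a j - x)\<^sup>2)"
proof -
  define s where "s = (\<Sum>j\<in>I. w j * a j)"
  have "0 \<le> (\<Sum>j\<in>I. w j * (a j - s)\<^sup>2)"
    using assms by (intro sum_nonneg) auto
  also have "\<dots> = (\<Sum>j\<in>I. w j * (a j - x)\<^sup>2 + (2 * x - 2 * s) * (w j * a j) + (s\<^sup>2 - x\<^sup>2) * w j)"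
    by (intro sum.cong refl) algebra
  also have "\<dots> = (\<Sum>j\<in>I. w j * (a j - x)\<^sup>2) + (2 * x - 2 * s) * s + (s\<^sup>2 - x\<^sup>2)"
    by (simp add: sum.distrib sum_distrib_left[symmetric] s_def assms(3))
  also have "\<dots> = (\<Sum>j\<in>I. w j * (a j - x)\<^sup>2) - (s - x)\<^sup>2"
    by algebra
  finally show ?thesis
    by (simp add: s_def)
qed

lemma sqd_weighted_mean_le:
  assumes "finite I" "\<And>j. j \<in> I \<Longrightarrow> 0 \<le> w j" "(\<Sum>j\<in>I. w j) = 1"
  shows "sqd d (\<lambda>i. \<Sum>j\<in>I. w j * c j i) x \<le> (\<Sum>j\<in>I. w j * sqd d (c j) x)"
proof -
  have "sqd d (\<lambda>i. \<Sum>j\<in>I. w j * c j i) x \<le> (\<Sum>i<d. \<Sum>j\<in>I. w j * (c j i - x i)\<^sup>2)"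
    unfolding sqd_def by (intro sum_mono square_weighted_mean_le assms)
  also have "\<dots> = (\<Sum>j\<in>I. w j * sqd d (c j) x)"
    by (subst sum.swap) (simp add: sqd_def sum_distrib_left)
  finally show ?thesis .
qed

subsection \<open>Minimum enclosing balls\<close>

text \<open>Competing balls are given by a bound \<rho> on squared distances, so that later
  arguments need not take the root of the bound they construct.\<close>

lemma is_MEB_iff:
  assumes "P \<subseteq> Rd d"
  shows "is_MEB d P c r \<longleftrightarrow> c \<in> Rd d \<and> 0 \<le> r \<and> (\<forall>x\<in>P. sqd d c x \<le> r\<^sup>2) \<and>
           (\<forall>c' \<rho>. c' \<in> Rd d \<and> 0 \<le> \<rho> \<and> (\<forall>x\<in>P. sqd d c' x \<le> \<rho>) \<longrightarrow> r\<^sup>2 \<le> \<rho>)"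
proof -
  have ball: "P \<subseteq> closed_ball d c r \<longleftrightarrow> (\<forall>x\<in>P. sqd d c x \<le> r\<^sup>2)" if "0 \<le> r" for c r
    using assms that by (auto simp: closed_ball_def edist_le_iff)
  have "(\<forall>c' r'. c' \<in> Rd d \<and> 0 \<le> r' \<and> P \<subseteq> closed_ball d c' r' \<longrightarrow> r \<le> r') \<longleftrightarrow>
     (\<forall>c' \<rho>. c' \<in> Rd d \<and> 0 \<le> \<rho> \<and> (\<forall>x\<in>P. sqd d c' x \<le> \<rho>) \<longrightarrow> r\<^sup>2 \<le> \<rho>)" (is "?L \<longleftrightarrow> ?R")
    if "0 \<le> r"
  proof (intro iffI allI impI)
    fix c' \<rho> assume L: ?L and h: "c' \<in> Rd d \<and> 0 \<le> \<rho> \<and> (\<forall>x\<in>P. sqd d c' x \<le> \<rho>)"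
    have "c' \<in> Rd d \<and> 0 \<le> sqrt \<rho> \<and> P \<subseteq> closed_ball d c' (sqrt \<rho>)"
      using h ball[of "sqrt \<rho>" c'] by simp
    then have "r \<le> sqrt \<rho>" using L by blast
    then have "r\<^sup>2 \<le> (sqrt \<rho>)\<^sup>2" using that by (rule power_mono)
    then show "r\<^sup>2 \<le> \<rho>" using h by simp
  next
    fix c' r' assume R: ?R and h: "c' \<in> Rd d \<and> 0 \<le> r' \<and> P \<subseteq> closed_ball d c' r'"
    have "c' \<in> Rd d \<and> 0 \<le> r'\<^sup>2 \<and> (\<forall>x\<in>P. sqd d c' x \<le> r'\<^sup>2)"
      using h ball[of r' c'] by simp
    then have "r\<^sup>2 \<le> r'\<^sup>2" using R by blast
    then show "r \<le> r'"
      using h by (blast intro: power2_le_imp_le)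
  qed
  then show ?thesis
    unfolding is_MEB_def using ball[of r c] by argo
qed

text \<open>A minimizing sequence of centers is Cauchy in every coordinate by the parallelogram law,
  and its limit is optimal.\<close>

lemma ex_is_MEB:
  assumes "finite P" "P \<subseteq> Rd d"
  shows "\<exists>c r. is_MEB d P c r"
proof (cases "P = {}")
  case True
  have "is_MEB d P (\<lambda>_. 0) 0"
    using True by (simp add: is_MEB_def Rd_iff)
  then show ?thesis by blast
next
  case False
  define A where "A = {\<rho>. \<exists>c\<in>Rd d. \<forall>x\<in>P. sqd d c x \<le> \<rho>}"
  have lower: "0 \<le> \<rho>" if "\<rho> \<in> A" for \<rho>
    using that False sqd_nonneg order_trans unfolding A_def by blast
  then have bdd: "bdd_below A" by (meson bdd_belowI)
  have "Max (sqd d (\<lambda>_. 0) ` P) \<in> A"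
    using assms unfolding A_def by (auto intro!: bexI[of _ "\<lambda>_. 0"] simp: Rd_iff)
  then have "A \<noteq> {}" by blast
  define R where "R = Inf A"
  have R_le: "R \<le> \<rho>" if "\<rho> \<in> A" for \<rho>
    using that bdd by (simp add: R_def cInf_lower)
  have "0 \<le> R"
    unfolding R_def using \<open>A \<noteq> {}\<close> lower by (intro cInf_greatest) auto
  have "\<exists>\<rho>\<in>A. \<rho> < R + 1 / real (Suc n)" for n
    using cInf_lessD[OF \<open>A \<noteq> {}\<close>, of "R + 1 / real (Suc n)"] by (simp add: R_def)
  then have "\<exists>c\<in>Rd d. \<forall>x\<in>P. sqd d c x \<le> R + 1 / real (Suc n)" for n
    unfolding A_def by (smt (verit) mem_Collect_eq)
  then obtain c where c: "\<And>n. c n \<in> Rd d" "\<And>n x. x \<in> P \<Longrightarrow> sqd d (c n) x \<le> R + 1 / real (Suc n)"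
    by metis
  \<comment> \<open>The midpoint of two nearly optimal centers lowers the common bound by a quarter
    of their squared distance; the result \<open>b\<close> cannot fall below the infimum
    \<open>R\<close>.\<close>
  have near: "sqd d (c n) (c k) \<le> 4 / real (Suc N)" if "N \<le> n" "N \<le> k" for N n k
  proof -
    define b where "b = R + 1 / real (Suc N) - sqd d (c n) (c k) / 4"
    have le: "sqd d (c j) x \<le> R + 1 / real (Suc N)" if "x \<in> P" "N \<le> j" for x j
    proof -
      have "1 / real (Suc j) \<le> 1 / real (Suc N)"
        using that by (intro divide_left_mono) auto
      then show ?thesis using c(2)[OF that(1), of j] by linarith
    qed
    have "b \<in> A"
      unfolding A_def
    proof (intro CollectI bexI ballI)
      fix x assume "x \<in> P"
      have "sqd d (\<lambda>i. (1 - 1 / 2) * c n i + 1 / 2 * c k i) x =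
          (1 - 1 / 2) * sqd d (c n) x + 1 / 2 * sqd d (c k) x - 1 / 2 * (1 - 1 / 2) * sqd d (c n) (c k)"
        by (rule sqd_segment)
      then show "sqd d (\<lambda>i. (1 - 1 / 2) * c n i + 1 / 2 * c k i) x \<le> b"
        using le[OF \<open>x \<in> P\<close> that(1)] le[OF \<open>x \<in> P\<close> that(2)] by (simp add: b_def)
    next
      show "(\<lambda>i. (1 - 1 / 2) * c n i + 1 / 2 * c k i) \<in> Rd d"
        using c(1) unfolding Rd_iff by simp
    qed
    then have "R \<le> b" by (rule R_le)
    then show ?thesis by (simp add: b_def)
  qed
  have cauchy: "Cauchy (\<lambda>n. c n i)" if "i < d" for i
  proof (rule metric_CauchyI)
    fix e :: real assume "0 < e"
    obtain N :: nat where N: "4 / e\<^sup>2 < real N"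
      using reals_Archimedean2 by blast
    have "dist (c n i) (c k i) < e" if "N \<le> n" "N \<le> k" for n k
    proof -
      have "(c n i - c k i)\<^sup>2 \<le> sqd d (c n) (c k)"
        unfolding sqd_def using \<open>i < d\<close> by (intro member_le_sum) auto
      also have "\<dots> \<le> 4 / real (Suc N)"
        using near that by blast
      also have "\<dots> < e\<^sup>2"
        using N \<open>0 < e\<close> by (simp add: field_simps) (smt (verit) zero_less_power)
      finally have "\<bar>c n i - c k i\<bar>\<^sup>2 < e\<^sup>2" by simp
      then show ?thesis
        using \<open>0 < e\<close> power2_less_imp_less[of "\<bar>c n i - c k i\<bar>" e] by (simp add: dist_real_def)
    qed
    then show "\<exists>M. \<forall>m\<ge>M. \<forall>n\<ge>M. dist (c m i) (c n i) < e" by blast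
  qed
  \<comment> \<open>From index \<open>d\<close> on the sequence is constantly zero, so the
    coordinatewise limit stays in \<open>Rd d\<close>.\<close>
  define z where "z = (\<lambda>i. lim (\<lambda>n. c n i))"
  have "\<And>i n. i \<ge> d \<Longrightarrow> c n i = 0"
    using c(1) by (simp add: Rd_iff)
  then have z: "z \<in> Rd d"
    by (simp add: z_def Rd_iff)
  have lim_c: "(\<lambda>n. c n i) \<longlonglongrightarrow> z i" if "i < d" for i
    using cauchy[OF that] by (simp add: z_def Cauchy_convergent_iff convergent_LIMSEQ_iff)
  have zR: "sqd d z x \<le> R" if "x \<in> P" for x
  proof (rule LIMSEQ_le)
    show "(\<lambda>n. sqd d (c n) x) \<longlonglongrightarrow> sqd d z x"
      unfolding sqd_def by (intro tendsto_intros lim_c) auto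
    show "(\<lambda>n. R + 1 / real (Suc n)) \<longlonglongrightarrow> R"
      by real_asymp
    show "\<exists>N. \<forall>n\<ge>N. sqd d (c n) x \<le> R + 1 / real (Suc n)"
      using c(2) that by blast
  qed
  have "is_MEB d P z (sqrt R)"
    unfolding is_MEB_iff[OF assms(2)] using z zR \<open>0 \<le> R\<close> R_le by (auto simp: A_def)
  then show ?thesis by blast
qed

lemma is_MEB_radius_unique: "is_MEB d P c r \<Longrightarrow> is_MEB d P c' r' \<Longrightarrow> r = r'"
  unfolding is_MEB_def by (meson order_antisym)

lemma Rad_eqI: "is_MEB d P c r \<Longrightarrow> Rad d P = r"
  unfolding Rad_def by (rule the_equality) (auto intro: is_MEB_radius_unique)

text \<open>A choice is made because every point of \<open>Rd d\<close> is a center for the empty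
  set; for nonempty sets the center is unique.\<close>

definition meb_center :: "nat \<Rightarrow> (nat \<Rightarrow> real) set \<Rightarrow> nat \<Rightarrow> real" where
  "meb_center d P = (SOME c. is_MEB d P c (Rad d P))"

lemma is_MEB_meb_center:
  assumes "finite P" "P \<subseteq> Rd d"
  shows "is_MEB d P (meb_center d P) (Rad d P)"
proof -
  have "\<exists>c. is_MEB d P c (Rad d P)"
    using ex_is_MEB[OF assms] Rad_eqI by blast
  then show ?thesis
    unfolding meb_center_def by (rule someI_ex)
qed

lemma Rad_nonneg: "finite P \<Longrightarrow> P \<subseteq> Rd d \<Longrightarrow> 0 \<le> Rad d P"
  using is_MEB_meb_center[of P d] unfolding is_MEB_def by blast

lemma Rad_le:
  assumes "finite P" "c \<in> Rd d" "0 \<le> r" "P \<subseteq> closed_ball d c r"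
  shows "Rad d P \<le> r"
proof -
  have "P \<subseteq> Rd d" using assms(4) by (auto simp: closed_ball_def)
  then show ?thesis
    using is_MEB_meb_center[OF assms(1)] assms unfolding is_MEB_def by blast
qed

lemma Rad_mono:
  assumes "finite P" "P \<subseteq> Rd d" "Q \<subseteq> P"
  shows "Rad d Q \<le> Rad d P"
proof -
  have "meb_center d P \<in> Rd d" "0 \<le> Rad d P" "P \<subseteq> closed_ball d (meb_center d P) (Rad d P)"
    using is_MEB_meb_center[OF assms(1,2)] unfolding is_MEB_def by blast+
  then show ?thesis
    using assms by (intro Rad_le[of _ "meb_center d P"]) (auto intro: finite_subset)
qed

text \<open>Moving from the optimal center towards \<open>c'\<close> must not shrink the enclosing ball; this is
  compared to first order in \<open>t\<close>.\<close>

lemma sqd_center_le: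
  assumes "P \<subseteq> Rd d" "P \<noteq> {}" and meb: "is_MEB d P c r"
    and c': "c' \<in> Rd d" and encl: "0 \<le> r'" "P \<subseteq> closed_ball d c' r'"
  shows "sqd d c c' \<le> r'\<^sup>2 - r\<^sup>2"
proof (rule ccontr)
  assume less: "\<not> sqd d c c' \<le> r'\<^sup>2 - r\<^sup>2"
  note M = meb[unfolded is_MEB_iff[OF assms(1)]]
  have c'r: "sqd d c' x \<le> r'\<^sup>2" if "x \<in> P" for x
    using encl that by (auto simp: closed_ball_def edist_le_iff)
  have key: "(1 - t) * sqd d c c' \<le> r'\<^sup>2 - r\<^sup>2" if t: "0 < t" "t < 1" for t
  proof -
    define b where "b = (1 - t) * r\<^sup>2 + t * r'\<^sup>2 - t * (1 - t) * sqd d c c'"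
    have le: "sqd d (\<lambda>i. (1 - t) * c i + t * c' i) x \<le> b" if "x \<in> P" for x
    proof -
      have "(1 - t) * sqd d c x \<le> (1 - t) * r\<^sup>2" "t * sqd d c' x \<le> t * r'\<^sup>2"
        using t M c'r that by (auto intro!: mult_left_mono)
      then show ?thesis by (simp add: sqd_segment b_def)
    qed
    have "0 \<le> b"
      using le sqd_nonneg order_trans \<open>P \<noteq> {}\<close> by blast
    moreover have "(\<lambda>i. (1 - t) * c i + t * c' i) \<in> Rd d"
      using M c' unfolding Rd_iff by simp
    ultimately have "r\<^sup>2 \<le> b"
      using M le by blast
    then have "t * ((1 - t) * sqd d c c') \<le> t * (r'\<^sup>2 - r\<^sup>2)"
      by (simp add: b_def algebra_simps)
    then show ?thesis using t by simp
  qed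
  \<comment> \<open>Dividing by \<open>t\<close> left the factor \<open>1 - t\<close>, which
    disappears in the limit at zero from the right.\<close>
  have "((\<lambda>t. (1 - t) * sqd d c c') \<longlongrightarrow> (1 - 0) * sqd d c c') (at_right 0)"
    by (intro tendsto_intros)
  moreover have "\<forall>\<^sub>F t in at_right (0::real). (1 - t) * sqd d c c' \<le> r'\<^sup>2 - r\<^sup>2"
    using eventually_at_right_real[of 0 "1::real"] by (auto elim!: eventually_mono intro: key)
  ultimately have "(1 - 0) * sqd d c c' \<le> r'\<^sup>2 - r\<^sup>2"
    by (intro tendsto_upperbound) auto
  with less show False by simp
qed

text \<open>Both radii agree, so the bound on the squared distance of the centers is a difference of
  equal squares.\<close>

lemma meb_center_unique:
  assumes "P \<subseteq> Rd d" "P \<noteq> {}" "is_MEB d P c r" "is_MEB d P c' r'"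
  shows "c = c'"
proof -
  have "r = r'" using assms(3,4) by (rule is_MEB_radius_unique)
  then have "sqd d c c' \<le> 0"
    using sqd_center_le[OF assms(1-3), of c' r'] assms(4) unfolding is_MEB_def by auto
  then have "sqd d c c' = 0" using sqd_nonneg[of d c c'] by linarith
  moreover have "c \<in> Rd d" "c' \<in> Rd d" using assms(3,4) unfolding is_MEB_def by blast+
  ultimately show ?thesis using sqd_eq_0_iff by blast
qed

text \<open>This is the hull operator of the compression scheme.\<close>

definition meb :: "nat \<Rightarrow> (nat \<Rightarrow> real) set \<Rightarrow> (nat \<Rightarrow> real) set" where
  "meb d P = closed_ball d (meb_center d P) (Rad d P)"

lemma subset_meb: "finite P \<Longrightarrow> P \<subseteq> Rd d \<Longrightarrow> P \<subseteq> meb d P"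
  using is_MEB_meb_center[of P d] unfolding meb_def is_MEB_def by blast

text \<open>The optimal ball of \<open>S\<close> also encloses \<open>T\<close> and has the optimal
  radius for \<open>T\<close>, so uniqueness of the center identifies the two balls.\<close>

lemma meb_eq_of_Rad_eq:
  assumes "finite S" "S \<subseteq> Rd d" "T \<subseteq> S" "T \<noteq> {}" "Rad d T = Rad d S"
  shows "meb d T = meb d S"
proof -
  have T: "finite T" "T \<subseteq> Rd d" using assms by (auto intro: finite_subset)
  have "is_MEB d T (meb_center d S) (Rad d S)"
    using is_MEB_meb_center[OF assms(1,2)] is_MEB_meb_center[OF T] assms(3)
    unfolding is_MEB_def assms(5) by blast
  then have "meb_center d T = meb_center d S"
    using meb_center_unique[OF T(2) assms(4) is_MEB_meb_center[OF T]] by blast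
  then show ?thesis by (simp add: meb_def assms(5))
qed

subsection \<open>Few points determine the ball\<close>

text \<open>Gaussian elimination, by induction on the number \<open>n\<close> of equations in more
  than \<open>n\<close> unknowns.\<close>

lemma homogeneous_system_nontrivial_solution:
  fixes a :: "nat \<Rightarrow> 'a \<Rightarrow> real"
  assumes "finite I" "n < card I"
  shows "\<exists>u. (\<exists>j\<in>I. u j \<noteq> 0) \<and> (\<forall>i<n. (\<Sum>j\<in>I. u j * a i j) = 0)"
  using assms
proof (induction n arbitrary: I a)
  case 0
  then have "I \<noteq> {}" by auto
  then show ?case by (intro exI[of _ "\<lambda>_. 1"]) auto
next
  case (Suc n)
  show ?case
  proof (cases "\<forall>j\<in>I. a n j = 0")
    case True
    obtain u where "\<exists>j\<in>I. u j \<noteq> 0" "\<forall>i<n. (\<Sum>j\<in>I. u j * a i j) = 0"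
      using Suc.IH[of I a] Suc.prems by auto
    then show ?thesis using True by (intro exI[of _ u]) (auto simp: less_Suc_eq)
  next
    case False
    then obtain p where p: "p \<in> I" "a n p \<noteq> 0" by blast
    \<comment> \<open>Equation \<open>n\<close> is solved for the unknown at the pivot
      \<open>p\<close>; \<open>b\<close> holds the coefficients of the other equations after
      substitution.\<close>
    define I' where "I' = I - {p}"
    define b where "b = (\<lambda>i j. a i j - a n j / a n p * a i p)"
    have I': "finite I'" "n < card I'"
      using Suc.prems p by (auto simp: I'_def)
    obtain u where u: "\<exists>j\<in>I'. u j \<noteq> 0" "\<forall>i<n. (\<Sum>j\<in>I'. u j * b i j) = 0"
      using Suc.IH[OF I', of b] by blast
    define s where "s = (\<Sum>j\<in>I'. u j * a n j)"
    define v where "v = u(p := - (s / a n p))"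
    have sum_v: "(\<Sum>j\<in>I. v j * a i j) = (\<Sum>j\<in>I'. u j * a i j) - s / a n p * a i p" for i
    proof -
      have "(\<Sum>j\<in>I. v j * a i j) = v p * a i p + (\<Sum>j\<in>I'. v j * a i j)"
        using Suc.prems(1) p(1) by (simp add: I'_def sum.remove)
      also have "(\<Sum>j\<in>I'. v j * a i j) = (\<Sum>j\<in>I'. u j * a i j)"
        by (intro sum.cong) (auto simp: v_def I'_def)
      finally show ?thesis by (simp add: v_def)
    qed
    have "(\<Sum>j\<in>I. v j * a i j) = 0" if "i < Suc n" for i
    proof (cases "i = n")
      case True
      then show ?thesis using p by (simp add: sum_v s_def)
    next
      case False
      then have "0 = (\<Sum>j\<in>I'. u j * b i j)" using u that by auto
      also have "\<dots> = (\<Sum>j\<in>I'. u j * a i j - a i p / a n p * (u j * a n j))"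
        by (intro sum.cong) (auto simp: b_def algebra_simps)
      also have "\<dots> = (\<Sum>j\<in>I. v j * a i j)"
        by (simp add: sum_v s_def sum_subtractf sum_distrib_left sum_divide_distrib algebra_simps)
      finally show ?thesis by simp
    qed
    moreover have "\<exists>j\<in>I. v j \<noteq> 0"
      using u(1) by (auto simp: v_def I'_def)
    ultimately show ?thesis by blast
  qed
qed

text \<open>Radon's theorem: an affine dependence is split by the sign of its coefficients. The
  family is indexed because points with different indices may coincide.\<close>

lemma Radon_indexed:
  fixes c :: "'a \<Rightarrow> nat \<Rightarrow> real"
  assumes "finite I" "d + 1 < card I"
  obtains J K v w where "J \<subseteq> I" "K \<subseteq> I" "J \<inter> K = {}"
    "\<And>j. j \<in> J \<Longrightarrow> 0 \<le> v j" "sum v J = 1" "\<And>j. j \<in> K \<Longrightarrow> 0 \<le> w j" "sum w K = 1"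
    "\<And>i. i < d \<Longrightarrow> (\<Sum>j\<in>J. v j * c j i) = (\<Sum>j\<in>K. w j * c j i)"
proof -
  \<comment> \<open>Row \<open>d\<close> of ones forces the coefficients to sum to zero, which makes
    the dependence affine.\<close>
  define a where "a = (\<lambda>i j. if i = d then 1 else c j i)"
  obtain u where u: "\<exists>j\<in>I. u j \<noteq> 0" "\<forall>i<d+1. (\<Sum>j\<in>I. u j * a i j) = 0"
    using homogeneous_system_nontrivial_solution[OF assms] by blast
  have u0: "sum u I = 0" using u(2)[rule_format, of d] by (simp add: a_def)
  have uc: "(\<Sum>j\<in>I. u j * c j i) = 0" if "i < d" for i
    using u(2)[rule_format, of i] that by (simp add: a_def)
  define J where "J = {j\<in>I. 0 < u j}"
  define K where "K = {j\<in>I. u j \<le> 0}"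
  define s where "s = sum u J"
  have split: "sum f I = sum f J + sum f K" for f :: "'a \<Rightarrow> real"
  proof -
    have "sum f (J \<union> K) = sum f J + sum f K"
      using assms(1) by (intro sum.union_disjoint) (auto simp: J_def K_def)
    moreover have "J \<union> K = I" by (auto simp: J_def K_def)
    ultimately show ?thesis by simp
  qed
  \<comment> \<open>If the positive part vanished, the zero total would make the nonpositive part
    vanish too, against nontriviality of \<open>u\<close>.\<close>
  have "s > 0"
  proof (rule ccontr)
    assume "\<not> 0 < s"
    moreover have "0 \<le> s" unfolding s_def by (intro sum_nonneg) (auto simp: J_def)
    ultimately have s0: "s = 0" by simp
    then have J0: "\<forall>j\<in>J. u j = 0"
      unfolding s_def using assms(1) by (subst (asm) sum_nonneg_eq_0_iff) (auto simp: J_def)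
    have "(\<Sum>j\<in>K. - u j) = 0" using split[of u] u0 s0 by (simp add: s_def sum_negf)
    then have "\<forall>j\<in>K. - u j = 0"
      using assms(1) by (subst (asm) sum_nonneg_eq_0_iff) (auto simp: K_def)
    moreover have "I \<subseteq> J \<union> K" by (auto simp: J_def K_def)
    ultimately show False using u(1) J0 by auto
  qed
  show thesis
  proof (rule that[of J K "\<lambda>j. u j / s" "\<lambda>j. - u j / s"])
    show "J \<subseteq> I" "K \<subseteq> I" "J \<inter> K = {}" by (auto simp: J_def K_def)
    show "0 \<le> u j / s" if "j \<in> J" for j using that \<open>s > 0\<close> by (simp add: J_def)
    show "0 \<le> - u j / s" if "j \<in> K" for j using that \<open>s > 0\<close> by (simp add: K_def divide_nonpos_pos)
    show "(\<Sum>j\<in>J. u j / s) = 1" using \<open>s > 0\<close> by (simp add: sum_divide_distrib[symmetric] s_def)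
    have "sum u K = - s" using split[of u] u0 by (simp add: s_def)
    then show "(\<Sum>j\<in>K. - u j / s) = 1"
      using \<open>s > 0\<close> by (simp add: sum_divide_distrib[symmetric] sum_negf)
    show "(\<Sum>j\<in>J. u j / s * c j i) = (\<Sum>j\<in>K. - u j / s * c j i)" if "i < d" for i
    proof -
      have "(\<Sum>j\<in>J. u j * c j i) = (\<Sum>j\<in>K. - u j * c j i)"
        using split[of "\<lambda>j. u j * c j i"] uc[OF that] by (simp add: sum_negf)
      then have "(\<Sum>j\<in>J. u j * c j i) / s = (\<Sum>j\<in>K. - u j * c j i) / s" by simp
      then show ?thesis by (simp add: sum_divide_distrib)
    qed
  qed
qed

text \<open>If \<open>T\<close> is a minimal subset with the radius of \<open>S\<close>, then the centers of the balls of
  \<open>T - {t}\<close> cannot have a Radon point, since that point would be too close to all of \<open>T\<close>.\<close>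

lemma ex_small_subset_same_Rad:
  assumes "finite S" "S \<subseteq> Rd d" "S \<noteq> {}"
  shows "\<exists>T\<subseteq>S. T \<noteq> {} \<and> card T \<le> d + 1 \<and> Rad d T = Rad d S"
proof -
  define R where "R = Rad d S"
  define Q where "Q = (\<lambda>T. T \<subseteq> S \<and> T \<noteq> {} \<and> Rad d T = R)"
  have "Q S" using assms by (simp add: Q_def R_def)
  then obtain T where T: "Q T" and min: "\<And>U. Q U \<Longrightarrow> card T \<le> card U"
    using ex_has_least_nat[of Q S card] by blast
  have fT: "finite T" "T \<subseteq> Rd d" "T \<noteq> {}" "T \<subseteq> S" "Rad d T = R"
    using T assms unfolding Q_def by (auto intro: finite_subset)
  have "card T \<le> d + 1"
  proof (rule ccontr)
    assume big: "\<not> card T \<le> d + 1"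
    define c where "c = (\<lambda>t. meb_center d (T - {t}))"
    have fTt: "finite (T - {t})" "T - {t} \<subseteq> Rd d" for t using fT by auto
    have c_Rd: "c t \<in> Rd d" for t
      using is_MEB_meb_center[OF fTt] by (simp add: c_def is_MEB_def)
    \<comment> \<open>By minimality of \<open>T\<close>, leaving out \<open>t\<close> strictly
      lowers the radius; the presence of \<open>s\<close> keeps the remaining set nonempty.\<close>
    have close: "sqd d (c t) s < R\<^sup>2" if "t \<in> T" "s \<in> T" "s \<noteq> t" for s t
    proof -
      have "\<not> Q (T - {t})"
      proof
        assume "Q (T - {t})"
        from min[OF this] show False
          using that fT(1) by (metis card_Diff1_less not_less)
      qed
      then have "Rad d (T - {t}) \<noteq> R"
        using that fT by (auto simp: Q_def)
      then have "Rad d (T - {t}) < R"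
        using Rad_mono[OF fT(1,2), of "T - {t}"] fT(5) by auto
      then have "(Rad d (T - {t}))\<^sup>2 < R\<^sup>2"
        using Rad_nonneg[OF fTt] by (intro power_strict_mono) auto
      moreover have "sqd d (c t) s \<le> (Rad d (T - {t}))\<^sup>2"
        using is_MEB_meb_center[OF fTt] that unfolding is_MEB_iff[OF fTt(2)] c_def by blast
      ultimately show ?thesis by linarith
    qed
    obtain J K v w where JK: "J \<subseteq> T" "K \<subseteq> T" "J \<inter> K = {}"
      and v: "\<And>j. j \<in> J \<Longrightarrow> 0 \<le> v j" "sum v J = 1"
      and w: "\<And>j. j \<in> K \<Longrightarrow> 0 \<le> w j" "sum w K = 1"
      and eq: "\<And>i. i < d \<Longrightarrow> (\<Sum>j\<in>J. v j * c j i) = (\<Sum>j\<in>K. w j * c j i)"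
      by (rule Radon_indexed[of T d c]) (use fT(1) big in auto)
    define z where "z = (\<lambda>i. \<Sum>j\<in>J. v j * c j i)"
    have z_Rd: "z \<in> Rd d"
      using c_Rd by (simp add: z_def Rd_iff)
    have z_eq: "sqd d z s = sqd d (\<lambda>i. \<Sum>j\<in>K. w j * c j i) s" for s
      unfolding sqd_def z_def by (intro sum.cong) (auto simp: eq)
    have strict: "sqd d (\<lambda>i. \<Sum>j\<in>L. u j * c j i) s < R\<^sup>2"
      if L: "L \<subseteq> T" and u: "\<And>j. j \<in> L \<Longrightarrow> 0 \<le> u j" "sum u L = 1" and s: "s \<in> T" "s \<notin> L"
      for L u s
    proof -
      have fL: "finite L" using L fT(1) finite_subset by blast
      have "L \<noteq> {}" using u(2) by auto
      define M where "M = Max ((\<lambda>j. sqd d (c j) s) ` L)"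
      have "M < R\<^sup>2"
        unfolding M_def using fL \<open>L \<noteq> {}\<close> close L s by (subst Max_less_iff) auto
      have "sqd d (\<lambda>i. \<Sum>j\<in>L. u j * c j i) s \<le> (\<Sum>j\<in>L. u j * sqd d (c j) s)"
        by (intro sqd_weighted_mean_le fL u)
      also have "\<dots> \<le> (\<Sum>j\<in>L. u j * M)"
        using u(1) fL by (intro sum_mono mult_left_mono) (auto simp: M_def)
      also have "\<dots> = M" by (simp add: sum_distrib_right[symmetric] u(2))
      finally show ?thesis using \<open>M < R\<^sup>2\<close> by simp
    qed
    \<comment> \<open>Since \<open>J\<close> and \<open>K\<close> are disjoint, \<open>s\<close> is
      missing from one of them, and \<open>z\<close> is a convex combination of the centers indexed
      by that one.\<close>
    have z_close: "sqd d z s < R\<^sup>2" if "s \<in> T" for s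
    proof (cases "s \<in> J")
      case True
      then show ?thesis using strict[OF JK(2) w that] JK(3) by (auto simp: z_eq)
    next
      case False
      then show ?thesis using strict[OF JK(1) v that] by (simp add: z_def)
    qed
    \<comment> \<open>Finiteness of \<open>T\<close> turns the pointwise strict bounds into one
      bound below \<open>R\<^sup>2\<close>, against optimality of \<open>R\<close>.\<close>
    define M where "M = Max (sqd d z ` T)"
    have "M < R\<^sup>2" unfolding M_def using fT z_close by (subst Max_less_iff) auto
    moreover have M: "sqd d z s \<le> M" if "s \<in> T" for s
      using fT(1) that by (simp add: M_def)
    moreover have "0 \<le> M" using M fT(3) sqd_nonneg order_trans by blast
    ultimately show False
      using is_MEB_meb_center[OF fT(1,2)] z_Rd unfolding is_MEB_iff[OF fT(2)] fT(5) by fastforce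
  qed
  then show ?thesis using fT by (auto simp: R_def)
qed

subsection \<open>Sample compression\<close>

text \<open>Each list of length \<open>m\<close> over \<open>P\<close> has the same product
  probability, so bounding probabilities becomes counting lists.\<close>

lemma replicate_pmf_of_set:
  assumes "finite P" "P \<noteq> {}"
  shows "replicate_pmf m (pmf_of_set P) = pmf_of_set {xs. set xs \<subseteq> P \<and> length xs = m}"
proof -
  let ?L = "{xs. set xs \<subseteq> P \<and> length xs = m}"
  have L: "finite ?L" "card ?L = card P ^ m"
    using assms(1) by (simp_all add: finite_lists_length_eq card_lists_length_eq)
  then have "?L \<noteq> {}"
    using assms by (metis card_eq_0_iff power_not_zero)
  have pmf: "pmf (replicate_pmf (length xs) (pmf_of_set P)) xs =
      (if set xs \<subseteq> P then 1 / real (card P) ^ length xs else 0)" for xs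
  proof (induction xs)
    case (Cons x xs)
    have "replicate_pmf (Suc n) p = map_pmf (\<lambda>(x, xs). x # xs) (pair_pmf p (replicate_pmf n p))"
      for n and p :: "'a pmf"
      by (simp add: pair_pmf_def map_bind_pmf)
    moreover have "inj (\<lambda>(x, xs). x # xs :: 'a list)"
      by (auto intro: injI)
    ultimately have "pmf (replicate_pmf (length (x # xs)) (pmf_of_set P)) (x # xs) =
        pmf (pair_pmf (pmf_of_set P) (replicate_pmf (length xs) (pmf_of_set P))) (x, xs)"
      using pmf_map_inj'[of "\<lambda>(x, xs). x # xs" _ "(x, xs)"] by (simp del: replicate_pmf.simps)
    then show ?case
      using Cons assms by (simp add: pmf_pair indicator_def del: replicate_pmf.simps)
  qed simp
  show ?thesis
  proof (rule pmf_eqI)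
    fix xs
    show "pmf (replicate_pmf m (pmf_of_set P)) xs = pmf (pmf_of_set ?L) xs"
    proof (cases "length xs = m")
      case True
      then show ?thesis
        using pmf[of xs] L \<open>?L \<noteq> {}\<close> by (auto simp: indicator_def)
    next
      case False
      then have "xs \<notin> set_pmf (replicate_pmf m (pmf_of_set P))"
        by (simp add: set_replicate_pmf)
      then show ?thesis
        using False L \<open>?L \<noteq> {}\<close> by (simp add: set_pmf_iff indicator_def)
    qed
  qed
qed

text \<open>Once the entries with index in \<open>J\<close> are fixed, each of the other \<open>m - card J\<close> entries has at most
  \<open>q * card P\<close> possible values.\<close>

lemma card_lists_within_hull_of_entries:
  fixes F :: "'a set \<Rightarrow> 'a set" and q :: real
  assumes "finite P" "J \<subseteq> {..<m}" "0 \<le> q"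
  shows "real (card {xs. set xs \<subseteq> P \<and> length xs = m \<and> set xs \<subseteq> F ((!) xs ` J) \<and>
            real (card (P \<inter> F ((!) xs ` J))) \<le> q * real (card P)})
         \<le> q ^ (m - card J) * real (card P) ^ m"
proof -
  define n where "n = real (card P)"
  let ?A = "{xs. set xs \<subseteq> P \<and> length xs = m \<and> set xs \<subseteq> F ((!) xs ` J) \<and>
               real (card (P \<inter> F ((!) xs ` J))) \<le> q * real (card P)}"
  \<comment> \<open>\<open>G\<close> collects the possible entries at the positions
    \<open>J\<close>, and \<open>E g\<close> the completions of \<open>g\<close> inside its hull.
    Lists are encoded as functions by \<open>\<phi>\<close> to count them as products.\<close>
  define G where "G = {g \<in> J \<rightarrow>\<^sub>E P. real (card (P \<inter> F (g ` J))) \<le> q * n}"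
  define E where "E = (\<lambda>g. \<Pi>\<^sub>E i\<in>{..<m}. if i \<in> J then {g i} else P \<inter> F (g ` J))"
  define \<phi> where "\<phi> = (\<lambda>xs :: 'a list. restrict ((!) xs) {..<m})"
  have fJ: "finite J" using assms(2) finite_subset by blast
  have fG: "finite G" unfolding G_def using fJ assms(1) by (simp add: finite_PiE)
  have fE: "finite (E g)" for g
    unfolding E_def using assms(1) by (intro finite_PiE) auto
  have "inj_on \<phi> ?A"
  proof (rule inj_onI)
    fix xs ys assume "xs \<in> ?A" "ys \<in> ?A" and eq: "\<phi> xs = \<phi> ys"
    then have "length xs = m" "length ys = m" by auto
    moreover have "xs ! i = ys ! i" if "i < m" for i
      using fun_cong[OF eq, of i] that by (simp add: \<phi>_def)
    ultimately show "xs = ys" by (auto intro: nth_equalityI)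
  qed
  moreover have "\<phi> ` ?A \<subseteq> (\<Union>g\<in>G. E g)"
  proof
    fix f assume "f \<in> \<phi> ` ?A"
    then obtain xs where xs: "xs \<in> ?A" and f: "f = \<phi> xs" by blast
    define g where "g = restrict ((!) xs) J"
    have gJ: "g ` J = (!) xs ` J" by (simp add: g_def)
    have mem: "xs ! i \<in> P" "xs ! i \<in> F ((!) xs ` J)" if "i < m" for i
      using xs that nth_mem[of i xs] by auto
    have "g \<in> G"
      using xs assms(2) mem unfolding G_def by (auto simp: gJ n_def) (auto simp: g_def)
    moreover have "f \<in> E g"
      unfolding E_def gJ f \<phi>_def using mem by (auto simp: g_def)
    ultimately show "f \<in> (\<Union>g\<in>G. E g)" by blast
  qed
  ultimately have "card ?A \<le> card (\<Union>g\<in>G. E g)"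
    using fG fE by (intro card_inj_on_le[of \<phi>]) auto
  also have "\<dots> \<le> (\<Sum>g\<in>G. card (E g))"
    by (rule card_UN_le[OF fG])
  finally have "real (card ?A) \<le> (\<Sum>g\<in>G. real (card (E g)))"
    unfolding of_nat_sum[symmetric] of_nat_le_iff .
  also have "\<dots> \<le> (\<Sum>g\<in>G. (q * n) ^ (m - card J))"
  proof (rule sum_mono)
    fix g assume "g \<in> G"
    have "card (E g) = (\<Prod>i<m. if i \<in> J then 1 else card (P \<inter> F (g ` J)))"
      unfolding E_def by (subst card_PiE) (auto intro: prod.cong)
    also have "\<dots> = (\<Prod>i\<in>{..<m} - J. card (P \<inter> F (g ` J)))"
      by (intro prod.mono_neutral_cong_right) auto
    also have "\<dots> = card (P \<inter> F (g ` J)) ^ (m - card J)"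
      using assms(2) fJ by (simp add: card_Diff_subset)
    finally show "real (card (E g)) \<le> (q * n) ^ (m - card J)"
      using \<open>g \<in> G\<close> by (simp add: G_def power_mono)
  qed
  also have "\<dots> = real (card G) * (q * n) ^ (m - card J)" by simp
  also have "\<dots> \<le> n ^ card J * (q * n) ^ (m - card J)"
  proof (rule mult_right_mono)
    have "card G \<le> card (J \<rightarrow>\<^sub>E P)"
      unfolding G_def using fJ assms(1) by (intro card_mono finite_PiE) auto
    also have "\<dots> = card P ^ card J"
      using fJ by (simp add: card_PiE)
    finally show "real (card G) \<le> n ^ card J"
      unfolding n_def of_nat_power[symmetric] of_nat_le_iff .
    show "0 \<le> (q * n) ^ (m - card J)" using assms(3) by (simp add: n_def)
  qed
  also have "\<dots> = q ^ (m - card J) * n ^ m"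
  proof -
    have "card J \<le> m" using card_mono[OF _ assms(2)] by simp
    then have "n ^ m = n ^ card J * n ^ (m - card J)" by (simp flip: power_add)
    then show ?thesis by (simp add: power_mult_distrib)
  qed
  finally show ?thesis by (simp add: n_def)
qed

text \<open>The generalisation bound for sample compression schemes: if the hull \<open>F S\<close> of the sample is
  determined by \<open>k\<close> of its points, a union bound over the positions of these points suffices.\<close>

lemma prob_sample_compression:
  fixes F :: "'a set \<Rightarrow> 'a set" and q :: real
  assumes "finite P" "P \<noteq> {}" "0 \<le> q" "q \<le> 1" "0 < m"
    and extensive: "\<And>S. S \<subseteq> P \<Longrightarrow> S \<subseteq> F S"
    and compress: "\<And>S. S \<subseteq> P \<Longrightarrow> S \<noteq> {} \<Longrightarrow> \<exists>T\<subseteq>S. T \<noteq> {} \<and> card T \<le> k \<and> F T = F S"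
  shows "measure_pmf.prob (replicate_pmf m (pmf_of_set P))
           {xs. real (card (P \<inter> F (set xs))) \<le> q * real (card P)} \<le> real m ^ k * q ^ (m - k)"
proof -
  define n where "n = real (card P)"
  have "0 < n" using assms(1,2) by (simp add: n_def card_gt_0_iff)
  let ?L = "{xs. set xs \<subseteq> P \<and> length xs = m}"
  have L: "finite ?L" "card ?L = card P ^ m"
    using assms(1) by (simp_all add: finite_lists_length_eq card_lists_length_eq)
  then have "?L \<noteq> {}"
    using assms(1,2) by (metis card_eq_0_iff power_not_zero)
  let ?B = "{xs. real (card (P \<inter> F (set xs))) \<le> q * real (card P)}"
  \<comment> \<open>Positions are chosen as \<open>k\<close>-tuples with repetition, so that
    \<open>m ^ k\<close> choices also cover compression sets with fewer than \<open>k\<close>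
    points.\<close>
  define H where "H = ({..<k} \<rightarrow>\<^sub>E {..<m})"
  define A where "A = (\<lambda>h. {xs. set xs \<subseteq> P \<and> length xs = m \<and> set xs \<subseteq> F ((!) xs ` h ` {..<k}) \<and>
            real (card (P \<inter> F ((!) xs ` h ` {..<k}))) \<le> q * real (card P)})"
  have fH: "finite H" and cH: "card H = m ^ k"
    by (simp_all add: H_def finite_PiE card_PiE)
  have fA: "finite (A h)" for h
    by (rule finite_subset[OF _ L(1)]) (auto simp: A_def)
  have "?L \<inter> ?B \<subseteq> (\<Union>h\<in>H. A h)"
  proof
    fix xs assume "xs \<in> ?L \<inter> ?B"
    then have xs: "set xs \<subseteq> P" "length xs = m"
      and bad: "real (card (P \<inter> F (set xs))) \<le> q * real (card P)" by auto
    have "set xs \<noteq> {}" using xs(2) \<open>0 < m\<close> by auto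
    then obtain T where T: "T \<subseteq> set xs" "T \<noteq> {}" "card T \<le> k" "F T = F (set xs)"
      using compress[OF xs(1)] by blast
    have fT: "finite T" using T(1) finite_subset by blast
    obtain t0 where t0: "t0 \<in> T" using T(2) by blast
    obtain e where e: "bij_betw e {0..<card T} T"
      using ex_bij_betw_nat_finite[OF fT] by blast
    have "\<forall>t\<in>T. \<exists>i<m. xs ! i = t"
      using T(1) xs(2) by (metis in_set_conv_nth subsetD)
    then obtain idx where idx: "\<And>t. t \<in> T \<Longrightarrow> idx t < m" "\<And>t. t \<in> T \<Longrightarrow> xs ! idx t = t"
      by metis
    \<comment> \<open>The enumeration of \<open>T\<close> is padded with \<open>t0\<close> to length
      \<open>k\<close>.\<close>
    define e' where "e' = (\<lambda>i. if i < card T then e i else t0)"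
    have e'T: "e' i \<in> T" for i
      using bij_betwE[OF e] t0 by (auto simp: e'_def)
    define h where "h = restrict (\<lambda>i. idx (e' i)) {..<k}"
    have "h \<in> H" using idx(1) e'T by (auto simp: h_def H_def)
    have "T \<subseteq> e' ` {..<k}"
    proof
      fix t assume "t \<in> T"
      then have "t \<in> e ` {0..<card T}" using e by (simp add: bij_betw_def)
      then obtain i where "i < card T" "e i = t" by auto
      then show "t \<in> e' ` {..<k}" using T(3) by (force simp: e'_def)
    qed
    then have "e' ` {..<k} = T" using e'T by blast
    moreover have "(!) xs ` h ` {..<k} = e' ` {..<k}"
      unfolding image_image using idx(2) e'T by (intro image_cong) (auto simp: h_def)
    ultimately have "(!) xs ` h ` {..<k} = T" by simp
    then have "xs \<in> A h"
      using xs bad T(4) extensive[OF xs(1)] by (simp add: A_def)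
    then show "xs \<in> (\<Union>h\<in>H. A h)" using \<open>h \<in> H\<close> by blast
  qed
  then have "card (?L \<inter> ?B) \<le> card (\<Union>h\<in>H. A h)"
    using fH fA by (intro card_mono) auto
  also have "\<dots> \<le> (\<Sum>h\<in>H. card (A h))" by (rule card_UN_le[OF fH])
  finally have "real (card (?L \<inter> ?B)) \<le> (\<Sum>h\<in>H. real (card (A h)))"
    unfolding of_nat_sum[symmetric] of_nat_le_iff .
  also have "\<dots> \<le> (\<Sum>h\<in>H. q ^ (m - k) * n ^ m)"
  proof (rule sum_mono)
    fix h assume "h \<in> H"
    then have sub: "h ` {..<k} \<subseteq> {..<m}" by (auto simp: H_def)
    \<comment> \<open>Repeated positions leave more than \<open>m - k\<close> free entries, which
      only helps because \<open>q \<le> 1\<close>.\<close>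
    have "card (h ` {..<k}) \<le> k" using card_image_le[of "{..<k}" h] by simp
    then have "q ^ (m - card (h ` {..<k})) \<le> q ^ (m - k)"
      using assms(3,4) by (intro power_decreasing) auto
    then have "q ^ (m - card (h ` {..<k})) * n ^ m \<le> q ^ (m - k) * n ^ m"
      using \<open>0 < n\<close> by (intro mult_right_mono) auto
    then show "real (card (A h)) \<le> q ^ (m - k) * n ^ m"
      using card_lists_within_hull_of_entries[OF assms(1) sub assms(3), of F]
      by (simp add: A_def n_def)
  qed
  also have "\<dots> = real m ^ k * q ^ (m - k) * n ^ m" by (simp add: cH)
  finally have "real (card (?L \<inter> ?B)) / n ^ m \<le> real m ^ k * q ^ (m - k)"
    using \<open>0 < n\<close> by (simp add: divide_le_eq)
  then show ?thesis
    using L \<open>?L \<noteq> {}\<close>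
    by (simp add: replicate_pmf_of_set[OF assms(1,2)] measure_pmf_of_set n_def)
qed

section \<open>Elementary logarithmic estimates for the sample size\<close>

text \<open>After \<open>1 - \<beta>\<^sub>0 \<le> exp (- \<beta>\<^sub>0)\<close> and taking
  logarithms, the linear term \<open>x = m \<beta>\<^sub>0\<close> has to dominate
  \<open>D * ln m\<close> with \<open>D = d + 1\<close>. Every other term is bounded by a multiple
  of \<open>M\<close>.\<close>

lemma sample_size_sufficient:
  assumes d: "1 \<le> d" and \<eta>: "0 < \<eta>" "\<eta> < 1" and \<beta>: "0 < \<beta>\<^sub>0" "\<beta>\<^sub>0 < 1"
    and m: "20 * sample_bound d \<beta>\<^sub>0 \<eta> \<le> real m"
  shows "0 < m" and "real m ^ (d + 1) * (1 - \<beta>\<^sub>0) ^ (m - (d + 1)) \<le> \<eta>"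
proof -
  define M where "M = Max {1, ln (1 / \<eta>), real d * ln (real d / \<beta>\<^sub>0)}"
  define D where "D = real d + 1"
  define b where "b = ln (1 / \<beta>\<^sub>0)"
  define x where "x = real m * \<beta>\<^sub>0"
  have M: "1 \<le> M" "ln (1 / \<eta>) \<le> M" "real d * ln (real d / \<beta>\<^sub>0) \<le> M"
    by (simp_all add: M_def)
  have "0 \<le> b" using \<beta> by (simp add: b_def)
  have "real d * ln (real d / \<beta>\<^sub>0) = real d * ln (real d) + real d * b"
    using d \<beta> by (simp add: b_def ln_div algebra_simps)
  with M have Mdb: "real d * ln (real d) + real d * b \<le> M" by simp
  have x: "20 * M \<le> x"
  proof -
    have "20 * M / \<beta>\<^sub>0 \<le> real m" using m by (simp add: sample_bound_def M_def)
    then show ?thesis using \<beta> by (simp add: x_def divide_le_eq)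
  qed
  have "x \<le> real m" using \<beta> by (simp add: x_def mult_left_le)
  show "0 < m" using x M(1) by (cases "m = 0") (auto simp: x_def)
  \<comment> \<open>This gives \<open>d - 1 \<le> d ln d\<close>, which bounds \<open>D\<close> by a
    multiple of \<open>M\<close>.\<close>
  have "ln (1 / real d) \<le> 1 / real d - 1" using d by (intro ln_le_minus_one) auto
  then have "1 - 1 / real d \<le> ln (real d)" using d by (simp add: ln_div)
  then have "real d * (1 - 1 / real d) \<le> real d * ln (real d)" by (intro mult_left_mono) auto
  then have "real d - 1 \<le> real d * ln (real d)" using d by (simp add: algebra_simps)
  moreover have "0 \<le> real d * b" using \<open>0 \<le> b\<close> by simp
  ultimately have D3: "D \<le> 3 * M" using Mdb M(1) unfolding D_def by linarith
  have "D \<le> 2 * real d" "2 \<le> D" using d by (auto simp: D_def)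
  have "ln (1 + 1 / real d) \<le> 1 / real d" using d by (intro ln_add_one_self_le_self) auto
  moreover have "ln D = ln (real d) + ln (1 + 1 / real d)"
  proof -
    have "D = real d * (1 + 1 / real d)" using d by (simp add: D_def field_simps)
    moreover have "0 < real d" "0 < 1 + 1 / real d" using d by (auto intro: add_pos_nonneg)
    ultimately show ?thesis by (simp only: ln_mult_pos)
  qed
  ultimately have "ln D \<le> ln (real d) + 1 / real d" by simp
  then have "D * (ln D + b) \<le> (2 * real d) * (ln (real d) + 1 / real d + b)"
    using \<open>D \<le> 2 * real d\<close> \<open>2 \<le> D\<close> \<open>0 \<le> b\<close> by (intro mult_mono) auto
  also have "\<dots> = 2 * (real d * ln (real d) + real d * b) + 2"
    using d by (simp add: algebra_simps)
  also have "\<dots> \<le> 4 * M" using Mdb M(1) by argo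
  finally have Dlog: "D * (ln D + b) \<le> 4 * M" .
  have "0 < x" using x M(1) by linarith
  \<comment> \<open>The tangent bound for \<open>ln\<close> is taken at \<open>x / (4 * D)\<close>,
    so that \<open>D * ln m\<close> costs only a quarter of \<open>x\<close>.\<close>
  have "ln (x / (4 * D)) \<le> x / (4 * D) - 1"
    using \<open>0 < x\<close> \<open>2 \<le> D\<close> by (intro ln_le_minus_one) auto
  moreover have "ln (4::real) \<le> 4 - 1" by (intro ln_le_minus_one) auto
  moreover have "ln (x / (4 * D)) = ln x - ln 4 - ln D"
    using \<open>0 < x\<close> \<open>2 \<le> D\<close> by (simp add: ln_div ln_mult)
  moreover have "ln (real m) = ln x + b"
    using \<open>0 < m\<close> \<beta> by (simp add: x_def b_def ln_mult ln_div)
  ultimately have "ln (real m) \<le> x / (4 * D) + 2 + (ln D + b)" by linarith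
  then have "D * ln (real m) \<le> D * (x / (4 * D) + 2 + (ln D + b))"
    using \<open>2 \<le> D\<close> by (intro mult_left_mono) auto
  also have "\<dots> = x / 4 + 2 * D + D * (ln D + b)"
    using \<open>2 \<le> D\<close> by (simp add: algebra_simps)
  also have "\<dots> \<le> x / 4 + 2 * (3 * M) + 4 * M"
    by (intro add_mono mult_left_mono Dlog D3) auto
  finally have Dlnm: "D * ln (real m) \<le> x / 4 + 10 * M" by simp
  \<comment> \<open>The constant 20 enters here:
    \<open>x / 4 + 10 * M + 3 * M - x \<le> - 2 * M\<close> once
    \<open>x \<ge> 20 * M\<close>.\<close>
  have "D * \<beta>\<^sub>0 \<le> D" using \<beta> \<open>2 \<le> D\<close> by (simp add: mult_left_le)
  then have expo: "D * ln (real m) - \<beta>\<^sub>0 * (real m - D) \<le> - M"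
    using Dlnm D3 x M(1) by (simp add: x_def algebra_simps)
  \<comment> \<open>This keeps the subtraction on naturals from truncating.\<close>
  have "d + 1 \<le> m" using D3 x \<open>x \<le> real m\<close> M(1) unfolding D_def by linarith
  then have mD: "real (m - (d + 1)) = real m - D" by (simp add: D_def)
  have "(1 - \<beta>\<^sub>0) ^ (m - (d + 1)) \<le> exp (- \<beta>\<^sub>0) ^ (m - (d + 1))"
    using \<beta> exp_ge_add_one_self[of "- \<beta>\<^sub>0"] by (intro power_mono) auto
  also have "\<dots> = exp (- \<beta>\<^sub>0 * (real m - D))"
    by (simp flip: exp_of_nat_mult mD add: mult.commute)
  finally have "real m ^ (d + 1) * (1 - \<beta>\<^sub>0) ^ (m - (d + 1))
      \<le> real m ^ (d + 1) * exp (- \<beta>\<^sub>0 * (real m - D))"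
    by (intro mult_left_mono) auto
  also have "\<dots> = exp (D * ln (real m) - \<beta>\<^sub>0 * (real m - D))"
  proof -
    have "D = real (d + 1)" by (simp add: D_def)
    then have "real m ^ (d + 1) = exp (D * ln (real m))"
      using \<open>0 < m\<close> by (simp only: exp_of_nat_mult) simp
    then show ?thesis by (simp flip: exp_add)
  qed
  also have "\<dots> \<le> exp (- ln (1 / \<eta>))"
    using expo M(2) by simp
  also have "\<dots> = \<eta>" using \<eta> by (simp add: ln_div)
  finally show "real m ^ (d + 1) * (1 - \<beta>\<^sub>0) ^ (m - (d + 1)) \<le> \<eta>" .
qed

subsection \<open>Quality of the output ball\<close>

lemma edist_le_mult_of_sqd_le:
  assumes "sqd d x y \<le> a * t\<^sup>2" "0 \<le> t" "0 \<le> a"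
  shows "edist d x y \<le> sqrt a * t"
  using assms by (simp add: edist_le_iff power_mult_distrib)

lemma approx_MEB_of_large_sample:
  assumes P: "finite P" "P \<subseteq> Rd d" and S: "S \<subseteq> P" "S \<noteq> {}"
    and \<epsilon>: "0 < \<epsilon>" "\<epsilon> < 1" and large: "(1 - \<epsilon>\<^sup>2) * Rad d P \<le> Rad d S"
    and approx: "approx_MEB d (\<epsilon>\<^sup>2) S c r"
    and r': "r' = (1 + (2 * sqrt 2 + sqrt 3) * \<epsilon>) / (1 - \<epsilon>\<^sup>2) * r"
  shows "P \<subseteq> closed_ball d c r'" and "r' \<le> approx_ratio \<epsilon> * Rad d P"
proof -
  have fS: "finite S" "S \<subseteq> Rd d" using P S by (auto intro: finite_subset)
  define R RS cP cS where "R = Rad d P" and "RS = Rad d S"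
    and "cP = meb_center d P" and "cS = meb_center d S"
  have mP: "is_MEB d P cP R" and mS: "is_MEB d S cS RS"
    unfolding R_def RS_def cP_def cS_def using P fS by (auto intro: is_MEB_meb_center)
  have c: "c \<in> Rd d" "0 \<le> r" "S \<subseteq> closed_ball d c r" "r \<le> (1 + \<epsilon>\<^sup>2) * RS"
    using approx by (auto simp: approx_MEB_def RS_def)
  have nn: "0 \<le> R" "0 \<le> RS" using mP mS by (auto simp: is_MEB_def)
  have "RS \<le> R" unfolding R_def RS_def by (rule Rad_mono[OF P S(1)])
  have "RS \<le> r" unfolding RS_def by (rule Rad_le[OF fS(1) c(1-3)])
  have \<epsilon>2: "0 < \<epsilon>\<^sup>2" "\<epsilon>\<^sup>2 < 1" using \<epsilon> by (auto simp: power_less_one_iff)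
  \<comment> \<open>The computed radius \<open>r\<close> bounds the unknown \<open>R\<close>; this
    produces the denominator in the output radius.\<close>
  have "(1 - \<epsilon>\<^sup>2) * R \<le> r" using large \<open>RS \<le> r\<close> by (simp add: R_def RS_def)
  then have Rr: "R \<le> r / (1 - \<epsilon>\<^sup>2)" using \<epsilon>2 by (simp add: le_divide_eq mult.commute)
  have "sqd d cS c \<le> r\<^sup>2 - RS\<^sup>2"
    by (rule sqd_center_le[OF fS(2) S(2) mS c(1-3)])
  also have "\<dots> \<le> ((1 + \<epsilon>\<^sup>2) * RS)\<^sup>2 - RS\<^sup>2"
    using c by (simp add: power_mono)
  also have "\<dots> = (2 + \<epsilon>\<^sup>2) * (\<epsilon> * RS)\<^sup>2" by algebra
  also have "\<dots> \<le> 3 * (\<epsilon> * R)\<^sup>2"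
    using \<epsilon> \<epsilon>2 nn \<open>RS \<le> R\<close> by (intro mult_mono power_mono) auto
  finally have d1: "edist d cS c \<le> sqrt 3 * (\<epsilon> * R)"
    using \<epsilon> nn by (intro edist_le_mult_of_sqd_le) auto
  \<comment> \<open>The optimal ball of \<open>P\<close> is one particular ball enclosing
    \<open>S\<close>, so the same center bound applies to it.\<close>
  have "sqd d cS cP \<le> R\<^sup>2 - RS\<^sup>2"
    using mP S(1) by (intro sqd_center_le[OF fS(2) S(2) mS]) (auto simp: is_MEB_def)
  also have "\<dots> \<le> R\<^sup>2 - ((1 - \<epsilon>\<^sup>2) * R)\<^sup>2"
    using large \<epsilon>2 nn by (auto simp: R_def RS_def intro!: power_mono)
  also have "\<dots> = (2 - \<epsilon>\<^sup>2) * (\<epsilon> * R)\<^sup>2" by algebra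
  also have "\<dots> \<le> 2 * (\<epsilon> * R)\<^sup>2"
    using \<epsilon>2 by (intro mult_right_mono) auto
  finally have d2: "edist d cS cP \<le> sqrt 2 * (\<epsilon> * R)"
    using \<epsilon> nn by (intro edist_le_mult_of_sqd_le) auto
  show "P \<subseteq> closed_ball d c r'"
  proof
    fix x assume "x \<in> P"
    then have "edist d cP x \<le> R" "x \<in> Rd d"
      using mP by (auto simp: is_MEB_def closed_ball_def)
    have "edist d c x \<le> edist d cS c + edist d cS cP + edist d cP x"
      using edist_triangle[of d c x cS] edist_triangle[of d cS x cP] edist_commute[of d c cS]
      by linarith
    also have "\<dots> \<le> sqrt 3 * (\<epsilon> * R) + sqrt 2 * (\<epsilon> * R) + R"
      using d1 d2 \<open>edist d cP x \<le> R\<close> by linarith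
    \<comment> \<open>The coefficient is enlarged to match the prescribed output radius.\<close>
    also have "\<dots> \<le> sqrt 3 * (\<epsilon> * R) + 2 * sqrt 2 * (\<epsilon> * R) + R"
      using \<epsilon> nn by simp
    also have "\<dots> = (1 + (2 * sqrt 2 + sqrt 3) * \<epsilon>) * R" by (simp add: algebra_simps)
    also have "\<dots> \<le> (1 + (2 * sqrt 2 + sqrt 3) * \<epsilon>) * (r / (1 - \<epsilon>\<^sup>2))"
      using Rr \<epsilon> by (intro mult_left_mono) auto
    finally show "x \<in> closed_ball d c r'"
      using \<open>x \<in> Rd d\<close> by (simp add: closed_ball_def r')
  qed
  have "r \<le> (1 + \<epsilon>\<^sup>2) * R"
    using c(4) \<open>RS \<le> R\<close> \<epsilon>2 by (smt (verit) mult_left_mono)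
  then have "r' \<le> (1 + (2 * sqrt 2 + sqrt 3) * \<epsilon>) / (1 - \<epsilon>\<^sup>2) * ((1 + \<epsilon>\<^sup>2) * R)"
    unfolding r' using \<epsilon> \<epsilon>2 by (intro mult_left_mono) auto
  then show "r' \<le> approx_ratio \<epsilon> * Rad d P"
    by (simp add: approx_ratio_def R_def)
qed

text \<open>\<open>C\<close> is chosen before \<open>d\<close>, hence absolute. The event quantifies
  over all approximate balls of the sample, so the guarantee covers any method of computing
  one.\<close>

theorem theorem3:
  shows "(\<exists>C>0. \<forall>(d::nat) (\<epsilon>::real) (\<eta>::real) (\<beta>\<^sub>0::real) (\<beta>::real) (P::(nat \<Rightarrow> real) set) (m::nat).
            1 \<le> d \<and> \<epsilon> \<in> {0<..<1} \<and> \<eta> \<in> {0<..<1} \<and> \<beta>\<^sub>0 \<in> {0<..<1} \<and> \<beta> \<in> {0<..<1} \<and>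
            P \<subseteq> Rd d \<and> finite P \<and> P \<noteq> {} \<and> stable_instance d P (\<epsilon>\<^sup>2) \<beta> \<and> \<beta> > \<beta>\<^sub>0 \<and>
            real m \<ge> C * sample_bound d \<beta>\<^sub>0 \<eta> \<longrightarrow>
            measure_pmf.prob (replicate_pmf m (pmf_of_set P))
              {xs. \<forall>c r. approx_MEB d (\<epsilon>\<^sup>2) (set xs) c r \<longrightarrow>
                     (let r' = (1 + (2 * sqrt 2 + sqrt 3) * \<epsilon>) / (1 - \<epsilon>\<^sup>2) * r
                      in P \<subseteq> closed_ball d c r' \<and> r' \<le> approx_ratio \<epsilon> * Rad d P)}
              \<ge> 1 - \<eta>)
         \<and> (\<lambda>\<epsilon>. approx_ratio \<epsilon> - 1) \<in> O[at_right 0](\<lambda>\<epsilon>. \<epsilon>)"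
proof (intro conjI exI[of _ "20::real"] allI impI)
  show "(0::real) < 20" by simp
  show "(\<lambda>\<epsilon>. approx_ratio \<epsilon> - 1) \<in> O[at_right 0](\<lambda>\<epsilon>. \<epsilon>)"
    unfolding approx_ratio_def by real_asymp
next
  fix d :: nat and \<epsilon> \<eta> \<beta>\<^sub>0 \<beta> :: real and P :: "(nat \<Rightarrow> real) set" and m :: nat
  assume h: "1 \<le> d \<and> \<epsilon> \<in> {0<..<1} \<and> \<eta> \<in> {0<..<1} \<and> \<beta>\<^sub>0 \<in> {0<..<1} \<and> \<beta> \<in> {0<..<1} \<and>
            P \<subseteq> Rd d \<and> finite P \<and> P \<noteq> {} \<and> stable_instance d P (\<epsilon>\<^sup>2) \<beta> \<and> \<beta> > \<beta>\<^sub>0 \<and>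
            real m \<ge> 20 * sample_bound d \<beta>\<^sub>0 \<eta>"
  then have P: "finite P" "P \<subseteq> Rd d" "P \<noteq> {}" and \<epsilon>: "0 < \<epsilon>" "\<epsilon> < 1"
    and stable: "stable_instance d P (\<epsilon>\<^sup>2) \<beta>" and \<beta>: "0 < \<beta>" "\<beta> < 1" "\<beta>\<^sub>0 < \<beta>"
    by auto
  have m: "0 < m" "real m ^ (d + 1) * (1 - \<beta>\<^sub>0) ^ (m - (d + 1)) \<le> \<eta>"
    using sample_size_sufficient[of d \<eta> \<beta>\<^sub>0 m] h by auto
  let ?p = "replicate_pmf m (pmf_of_set P)"
  let ?G = "{xs. \<forall>c r. approx_MEB d (\<epsilon>\<^sup>2) (set xs) c r \<longrightarrow>
                     (let r' = (1 + (2 * sqrt 2 + sqrt 3) * \<epsilon>) / (1 - \<epsilon>\<^sup>2) * r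
                      in P \<subseteq> closed_ball d c r' \<and> r' \<le> approx_ratio \<epsilon> * Rad d P)}"
  \<comment> \<open>The bad event: the optimal ball of the sample misses at least a \<beta> fraction
    of \<open>P\<close>.\<close>
  let ?B = "{xs. real (card (P \<inter> meb d (set xs))) \<le> (1 - \<beta>) * real (card P)}"
  have "measure_pmf.prob ?p ?B \<le> real m ^ (d + 1) * (1 - \<beta>) ^ (m - (d + 1))"
  proof (rule prob_sample_compression)
    show "S \<subseteq> meb d S" if "S \<subseteq> P" for S
      using that P by (intro subset_meb) (auto intro: finite_subset)
    show "\<exists>T\<subseteq>S. T \<noteq> {} \<and> card T \<le> d + 1 \<and> meb d T = meb d S" if "S \<subseteq> P" "S \<noteq> {}" for S
    proof -
      have S: "finite S" "S \<subseteq> Rd d" using that P by (auto intro: finite_subset)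
      then show ?thesis
        using ex_small_subset_same_Rad[OF S that(2)] meb_eq_of_Rad_eq[OF S] by blast
    qed
  qed (use P \<beta> m in auto)
  \<comment> \<open>The sample size is calibrated to the known lower bound
    \<open>\<beta>\<^sub>0\<close>, and the failure bound decreases in \<beta>.\<close>
  also have "\<dots> \<le> real m ^ (d + 1) * (1 - \<beta>\<^sub>0) ^ (m - (d + 1))"
    using \<beta> by (intro mult_left_mono power_mono) auto
  also note m(2)
  finally have "measure_pmf.prob ?p ?B \<le> \<eta>" .
  moreover have "measure_pmf.prob ?p (- ?B) = 1 - measure_pmf.prob ?p ?B"
    using measure_pmf.prob_compl[of ?B ?p] by (simp add: Compl_eq_Diff_UNIV)
  moreover have "measure_pmf.prob ?p (- ?B) \<le> measure_pmf.prob ?p ?G"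
  proof (rule measure_pmf.finite_measure_mono_AE)
    have "xs \<in> ?G" if xs: "xs \<in> set_pmf ?p" and good: "xs \<notin> ?B" for xs
    proof -
      have S: "set xs \<subseteq> P" "set xs \<noteq> {}"
        using xs P m(1) by (auto simp: set_replicate_pmf)
      then have fS: "set xs \<subseteq> Rd d" using P by auto
      \<comment> \<open>Outside the bad event the missed points \<open>Q\<close> are few enough for
        stability, while the optimal ball of the sample encloses \<open>P - Q\<close>; hence the
        sample has large radius.\<close>
      define Q where "Q = P - meb d (set xs)"
      have "card P = card (P \<inter> meb d (set xs)) + card Q"
        using P(1) by (simp add: Q_def card_Int_Diff)
      then have "real (card Q) < \<beta> * real (card P)"
        using good by (simp add: algebra_simps)
      moreover have "Q \<subseteq> P" by (auto simp: Q_def)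
      ultimately have "(1 - \<epsilon>\<^sup>2) * Rad d P < Rad d (P - Q)"
        using stable by (simp add: stable_instance_def)
      also have "\<dots> \<le> Rad d (set xs)"
        using is_MEB_meb_center[OF _ fS] P(1)
        by (intro Rad_le[of _ "meb_center d (set xs)"]) (auto simp: Q_def meb_def is_MEB_def)
      finally show ?thesis
        using approx_MEB_of_large_sample[OF P(1,2) S \<epsilon>] by (simp add: Let_def)
    qed
    then show "AE xs in ?p. xs \<in> - ?B \<longrightarrow> xs \<in> ?G"
      by (auto simp: AE_measure_pmf_iff)
  qed simp
  ultimately show "1 - \<eta> \<le> measure_pmf.prob ?p ?G" by linarith
qed

end
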